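(* As $n\to\infty$, $P(n,2)=\big(\gamma-o(1)\big)2^n$, where \[ \gamma=\frac12+\frac12\sum_{t\ge 2}\bigg(\prod_{i=2}^t\frac{i-1}{2^i-i-1}\bigg)=1.3296387925905428331319\ldots \]
   Context: For an integer $b\ge 1$, the state graph for $b$ balls is the infinite directed graph whose vertices (states) are the infinite $0$-$1$ sequences $\mathbf{c}=\langle c_1,c_2,\ldots\rangle$ (indexed by positive integers) containing exactly $b$ entries equal to $1$, with a directed edge $\mathbf{c}\to\mathbf{d}$ if and only if $d_i\ge c_{i+1}$ for all $i\ge 1$ (loops allowed). $P(n,b)$ denotes the number of directed cycles of length $n$ in this graph (closed walks $v_0\to\cdots\to v_n=v_0$ with $v_0,\ldots,v_{n-1}$ pairwise distinct, identified up to cyclic shift of the starting point; these are the prime juggling patterns of period $n$ with $b$ balls). *)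

theory Defs
  imports
    "HOL-Analysis.Infinite_Sum"
    "HOL-Library.Landau_Symbols"
    "Graph_Theory.Pair_Digraph"
begin

text \<open>
  Sequences are indexed from 0, so \<open>c j\<close> is the entry written \<open>c\<^sub>j\<^sub>+\<^sub>1\<close> when indexing by the
  positive integers.
\<close>

definition states :: "nat \<Rightarrow> (nat \<Rightarrow> nat) set" where
  "states b = {c. range c \<subseteq> {0, 1} \<and> finite {j. c j = 1} \<and> card {j. c j = 1} = b}"

definition state_graph :: "nat \<Rightarrow> (nat \<Rightarrow> nat) pair_pre_digraph" where
  "state_graph b =
     \<lparr>pverts = states b,
      parcs = {(c, d). c \<in> states b \<and> d \<in> states b \<and> (\<forall>i. d i \<ge> c (Suc i))}\<rparr>"

text \<open>
  A cycle is represented by its list of arcs, so its length is the number of arcs. The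
  notion \<^const>\<open>pre_digraph.cycle\<close> requires the list to be nonempty and admits loops.
\<close>

definition cycles_of_length :: "nat \<Rightarrow> nat \<Rightarrow> ((nat \<Rightarrow> nat) \<times> (nat \<Rightarrow> nat)) awalk set" where
  "cycles_of_length n b =
     {p. pre_digraph.cycle (with_proj (state_graph b)) p \<and> length p = n}"

definition cyclic_shift :: "('a list \<times> 'a list) set" where
  "cyclic_shift = {(p, q). \<exists>k. q = rotate k p}"

definition P :: "nat \<Rightarrow> nat \<Rightarrow> nat" where
  "P n b = card (cycles_of_length n b // cyclic_shift)"

definition juggling_gamma :: real where
  "juggling_gamma =
     1 / 2 + 1 / 2 * (\<Sum>\<^sub>\<infinity>t\<in>{2::nat..}. \<Prod>i = 2..t. (real i - 1) / (2 ^ i - real i - 1))"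

end

theory Submission
  imports Defs "HOL-Analysis.Analysis"
begin

text \<open>
  Write a state as a pair \<open>(x, c)\<close>: its balls sit at positions \<open>x\<close> and \<open>x + c\<close> with \<open>c \<ge> 1\<close>. While
  \<open>x > 0\<close> the successor is forced to be \<open>(x - 1, c)\<close>; from \<open>(0, b)\<close> one reaches \<open>(0, c)\<close> either in
  \<open>b\<close> steps, or, if \<open>c < b\<close>, in \<open>b - c\<close> steps (call \<open>c\<close> marked in the second case). A prime
  cycle is thus a cyclic arrangement of distinct gaps, some of them marked, where a marked gap is
  smaller than its predecessor, and the period is the sum of the unmarked gaps.

  Let \<open>h\<close> be the largest gap and \<open>T\<close> the set of the other unmarked gaps. Inserting the gaps below
  \<open>h\<close> in decreasing order, each new gap \<open>e\<close> can only go right before an unmarked gap, so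
  there are \<open>1 + card {t \<in> T. e < t}\<close> places for it. Given \<open>T\<close>, the number of cycles is therefore an
  explicit product, equal to \<open>2 ^ n\<close> times a weight that does not depend on \<open>n\<close>. As \<open>n\<close> grows, the
  admissible \<open>T\<close> exhaust the finite sets of positive integers, so \<open>P n 2 / 2 ^ n\<close> tends to the total
  weight. Splitting off the minimum of \<open>T\<close> and shifting the rest down turns that total, for each fixed
  cardinality, into a geometric series times the total for the preceding cardinality, which produces
  the product formula.
\<close>

section \<open>The weight of a set of unmarked gaps\<close>

definition factor :: "nat set \<Rightarrow> nat \<Rightarrow> real" where
  "factor T e = (if e \<in> T then 1 / 2 else 1 + real (card {t \<in> T. e < t}) / 2)"

text \<open>
  Every number \<open>e < h\<close>, used as a gap or not, contributes twice \<open>factor T e\<close> choices; the extra \<open>1 / 2\<close> belongs to \<open>h\<close>. Since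
  \<open>factor T e = 1\<close> for \<open>e\<close> above \<open>T\<close>, the product may stop at the maximum of \<open>T\<close>.
\<close>

definition weight :: "nat set \<Rightarrow> real" where
  "weight T = 1 / 2 * fact (card T) * (1 / 2) ^ (\<Sum>T) * (\<Prod>e = 1..Max (insert 0 T). factor T e)"

definition finsets :: "nat \<Rightarrow> nat set set" where
  "finsets k = {T. finite T \<and> 0 \<notin> T \<and> card T = k}"

definition gamma_summand :: "nat \<Rightarrow> real" where
  "gamma_summand t = (\<Prod>i = 2..t. (real i - 1) / (2 ^ i - real i - 1))"

lemma factor_nonneg: "factor T e \<ge> 0"
  by (simp add: factor_def)

lemma weight_nonneg: "weight T \<ge> 0"
  by (simp add: weight_def factor_nonneg prod_nonneg)

text \<open>Frees the product from the exact maximum of \<open>T\<close>: any common upper bound may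
  end it, as is needed for shifted sets and for gaps below a fixed \<open>h\<close>.\<close>

lemma weight_eq:
  assumes "finite T" "\<And>t. t \<in> T \<Longrightarrow> t \<le> N"
  shows "weight T = 1 / 2 * fact (card T) * (1 / 2) ^ (\<Sum>T) * (\<Prod>e = 1..N. factor T e)"
proof -
  have "factor T e = 1" if "e > Max (insert 0 T)" for e
  proof -
    have lt: "t < e" if "t \<in> T" for t
      using that \<open>e > Max (insert 0 T)\<close> assms(1) by simp
    then have "{t \<in> T. e < t} = {}" "e \<notin> T"
      by (auto dest: less_asym)
    then show ?thesis
      by (simp only: factor_def) simp
  qed
  moreover have "Max (insert 0 T) \<le> N"
    using assms by auto
  ultimately have "(\<Prod>e = 1..Max (insert 0 T). factor T e) = (\<Prod>e = 1..N. factor T e)"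
    by (intro prod.mono_neutral_left) auto
  then show ?thesis
    by (simp add: weight_def)
qed

text \<open>With \<open>k = card T\<close>, shifting by \<open>t\<close> carries the factors of
  \<open>T\<close> unchanged to positions above \<open>t\<close>, and \<open>t\<close> itself gives
  \<open>1 / 2\<close>. Each of the \<open>t - 1\<close> smaller numbers sees all
  \<open>k + 1\<close> elements and gives \<open>(k + 3) / 2\<close>. The exponent grows by
  \<open>t * (k + 1)\<close>, so for fixed \<open>T\<close> the weight is geometric in
  \<open>t\<close>.\<close>

lemma weight_insert_shift:
  assumes T: "finite T" "0 \<notin> T" and t: "t \<ge> 1"
  shows "weight (insert t ((+) t ` T)) =
    weight T * ((real (card T) + 1) * (1 / 2) ^ (card T + 2) * ((real (card T) + 3) / 2 ^ (card T + 2)) ^ (t - 1))"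
proof -
  define N where "N = Max (insert 0 T)"
  define U where "U = insert t ((+) t ` T)"
  define k where "k = card T"
  have notin: "t \<notin> (+) t ` T"
    using T by auto
  have cardU: "card U = k + 1"
    unfolding U_def k_def using T notin by (simp add: card_image)
  have sumU: "\<Sum>U = t * (k + 1) + \<Sum>T"
    unfolding U_def k_def using T notin by (simp add: sum.reindex sum.distrib algebra_simps)
  have leN: "x \<le> N" if "x \<in> T" for x
    using that T by (simp add: N_def)
  have lo: "factor U e = (real k + 3) / 2" if "e \<in> {1..<t}" for e
  proof -
    have "e \<notin> U" "{u \<in> U. e < u} = U"
      using that by (auto simp: U_def)
    then show ?thesis
      by (simp add: factor_def cardU)
  qed
  have hi: "factor U (t + e) = factor T e" if "e \<in> {1..N}" for e
  proof -
    have "{u \<in> U. t + e < u} = (+) t ` {u \<in> T. e < u}"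
      by (auto simp: U_def)
    moreover have "t + e \<in> U \<longleftrightarrow> e \<in> T"
      using that by (auto simp: U_def)
    ultimately show ?thesis
      by (simp add: factor_def card_image)
  qed
  have split: "{1..t + N} = {1..<t} \<union> ({t} \<union> (+) t ` {1..N})"
  proof -
    have "x \<in> (+) t ` {1..N}" if "t < x" "x \<le> t + N" for x
      using that by (intro image_eqI[of _ _ "x - t"]) auto
    then show ?thesis
      using t by fastforce
  qed
  have "(\<Prod>e = 1..t + N. factor U e) =
      (\<Prod>e \<in> {1..<t}. factor U e) * (factor U t * (\<Prod>e \<in> (+) t ` {1..N}. factor U e))"
  proof -
    have "{1..<t} \<inter> ({t} \<union> (+) t ` {1..N}) = {}" "t \<notin> (+) t ` {1..N}"
      by auto
    then show ?thesis
      unfolding split by (simp add: prod.union_disjoint)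
  qed
  also have "(\<Prod>e \<in> {1..<t}. factor U e) = ((real k + 3) / 2) ^ (t - 1)"
    by (simp add: lo)
  also have "factor U t = 1 / 2"
    by (simp add: factor_def U_def)
  also have "(\<Prod>e \<in> (+) t ` {1..N}. factor U e) = (\<Prod>e = 1..N. factor T e)"
    using hi by (subst prod.reindex) (auto intro!: prod.cong)
  finally have prod: "(\<Prod>e = 1..t + N. factor U e) =
    ((real k + 3) / 2) ^ (t - 1) * (1 / 2 * (\<Prod>e = 1..N. factor T e))" .
  \<comment> \<open>Separates the part that makes up \<open>weight T\<close> from the constant and
    from the two powers with exponent \<open>t - 1\<close>.\<close>
  have rearrange: "1 / 2 * (m * f) * (q * B * S) * (A * (1 / 2 * R)) =
      1 / 2 * f * S * R * (m * (q * (1 / 2)) * (B * A))" for m f q B S A R :: real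
    by simp
  have "weight U = 1 / 2 * fact (card U) * (1 / 2) ^ (\<Sum>U) * (\<Prod>e = 1..t + N. factor U e)"
    by (rule weight_eq) (use T leN in \<open>auto simp: U_def\<close>)
  also have "(1 / 2 :: real) ^ (\<Sum>U) = (1 / 2) ^ (k + 1) * ((1 / 2) ^ (k + 1)) ^ (t - 1) * (1 / 2) ^ (\<Sum>T)"
    unfolding sumU power_add[of _ "t * (k + 1)"]
    using t by (cases t) (simp_all only: power_mult[symmetric] power_add[symmetric], simp add: algebra_simps)
  also have "fact (card U) = (real k + 1) * fact k"
    by (simp add: cardU)
  also note prod
  also note rearrange
  also have "1 / 2 * fact k * (1 / 2) ^ (\<Sum>T) * (\<Prod>e = 1..N. factor T e) = weight T"
    by (simp add: weight_def N_def k_def)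
  also have "((1 / 2) ^ (k + 1)) ^ (t - 1) * ((real k + 3) / 2) ^ (t - 1) = ((real k + 3) / 2 ^ (k + 2)) ^ (t - 1)"
    unfolding power_mult_distrib[symmetric]
    by (rule arg_cong[of _ _ "\<lambda>x. x ^ (t - 1)"]) (simp add: power_one_over)
  also have "(1 / 2 :: real) ^ (k + 1) * (1 / 2) = (1 / 2) ^ (k + 2)"
    by simp
  finally show ?thesis
    by (simp only: U_def k_def)
qed

text \<open>The inverse removes the minimum and lowers the other elements by it; these exceed the
  minimum, so they stay positive and truncated subtraction is injective on them.\<close>

lemma bij_betw_finsets_Suc:
  "bij_betw (\<lambda>(t, T). insert t ((+) t ` T)) ({1..} \<times> finsets k) (finsets (Suc k))"
proof (rule bij_betwI[where g = "\<lambda>U. (Min U, (\<lambda>u. u - Min U) ` (U - {Min U}))"], goal_cases)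
  case 1
  show ?case
  proof (clarsimp simp: finsets_def, intro conjI)
    fix t :: nat and T :: "nat set" assume "Suc 0 \<le> t" "finite T" "0 \<notin> T"
    then have "t \<notin> (+) t ` T"
      by auto
    then show "card (insert t ((+) t ` T)) = Suc (card T)"
      using \<open>finite T\<close> by (simp add: card_image)
  qed auto
next
  case 2
  show ?case
  proof (rule funcsetI)
    fix U assume U: "U \<in> finsets (Suc k)"
    then have "U \<noteq> {}" "finite U"
      by (auto simp: finsets_def)
    then have M: "Min U \<in> U" and le: "\<And>u. u \<in> U \<Longrightarrow> Min U \<le> u"
      by simp_all
    have lt: "\<And>u. u \<in> U - {Min U} \<Longrightarrow> Min U < u"
      using le by fastforce
    then have "inj_on (\<lambda>u. u - Min U) (U - {Min U})"
      by (intro inj_onI) (metis less_imp_le_nat eq_diff_iff)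
    then have "card ((\<lambda>u. u - Min U) ` (U - {Min U})) = k"
      using U M by (simp add: card_image finsets_def)
    moreover have "0 \<notin> (\<lambda>u. u - Min U) ` (U - {Min U})"
      using lt by fastforce
    moreover have "Min U \<ge> 1"
      using U M by (cases "Min U") (auto simp: finsets_def)
    ultimately show "(Min U, (\<lambda>u. u - Min U) ` (U - {Min U})) \<in> {1..} \<times> finsets k"
      using \<open>finite U\<close> by (simp add: finsets_def)
  qed
next
  case (3 x)
  obtain t T where x: "x = (t, T)"
    by fastforce
  have T: "finite T" "0 \<notin> T"
    using 3 x by (auto simp: finsets_def)
  have M: "Min (insert t ((+) t ` T)) = t"
    by (rule Min_eqI) (use T in auto)
  moreover have "insert t ((+) t ` T) - {t} = (+) t ` T"
    using T by auto
  ultimately show ?case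
    unfolding x by (simp add: image_image)
next
  case (4 U)
  then have "U \<noteq> {}" "finite U"
    by (auto simp: finsets_def)
  then have M: "Min U \<in> U" and le: "\<And>u. u \<in> U \<Longrightarrow> Min U \<le> u"
    by simp_all
  have "(+) (Min U) ` (\<lambda>u. u - Min U) ` (U - {Min U}) = U - {Min U}"
    using le by (force simp: image_image)
  then show ?case
    using M by auto
qed

section \<open>Total weight of the sets of a given cardinality\<close>

lemma gamma_summand_Suc: "t \<ge> 1 \<Longrightarrow> gamma_summand (Suc t) = gamma_summand t * (real t / (2 ^ Suc t - real t - 2))"
  by (simp add: gamma_summand_def)

text \<open>Keeps the ratio \<open>(k + 3) / 2 ^ (k + 2)\<close> below 1 and the denominators
  \<open>2 ^ i - i - 1\<close> positive for \<open>i \<ge> 2\<close>.\<close>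

lemma power_two_ge: "2 ^ (k + 2) \<ge> real k + 4"
  by (induction k) auto

text \<open>Induction on the cardinality: summing over the minimum \<open>t\<close> multiplies the
  previous total by \<open>c / (1 - r)\<close>, which is exactly the factor of
  \<open>gamma_summand\<close> at \<open>i = k + 2\<close>.\<close>

lemma has_sum_weight_finsets: "(weight has_sum (1 / 2 * gamma_summand (Suc k))) (finsets k)"
proof (induction k)
  case 0
  have "finsets 0 = {{}}"
    by (auto simp: finsets_def)
  then show ?case
    using has_sum_finite[of "{{}}" weight] by (simp add: weight_def[of "{}"] gamma_summand_def)
next
  case (Suc k)
  define r where "r = (real k + 3) / 2 ^ (k + 2)"
  define c where "c = (real k + 1) * (1 / 2) ^ (k + 2)"
  have r: "0 \<le> r" "r < 1"
    using power_two_ge[of k] by (auto simp: r_def field_simps)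
  have "((\<lambda>t. r ^ (t - 1)) has_sum (1 / (1 - r))) {1..}"
  proof -
    have "((\<lambda>n. r ^ n) has_sum (1 / (1 - r))) UNIV"
      using r by (intro sums_nonneg_imp_has_sum geometric_sums) auto
    then show ?thesis
      by (subst has_sum_reindex_bij_witness[of _ Suc "\<lambda>t. t - 1" UNIV "\<lambda>n. r ^ n"]) auto
  qed
  from has_sum_cmult_right[OF this, of c]
  have geo: "((\<lambda>t. c * r ^ (t - 1)) has_sum (c / (1 - r))) {1..}"
    by simp
  define g where "g t = c * r ^ (t - 1) * (1 / 2 * gamma_summand (Suc k))" for t
  have outer: "(g has_sum (c / (1 - r) * (1 / 2 * gamma_summand (Suc k)))) {1..}"
    unfolding g_def by (rule has_sum_cmult_left[OF geo])
  define F where "F = (\<lambda>(t, T). weight T * (c * r ^ (t - 1)))"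
  have inner: "((\<lambda>T. F (t, T)) has_sum g t) (finsets k)" for t
    using has_sum_cmult_left[OF Suc.IH, of "c * r ^ (t - 1)"] by (simp add: F_def g_def mult_ac)
  \<comment> \<open>Nonnegativity of \<open>F\<close> lets summability of the iterated sum pass to
    the product set.\<close>
  have "F summable_on ({1..} \<times> finsets k)"
    by (intro summable_on_SigmaI[where g = g] inner)
      (use outer r in \<open>auto simp: summable_on_def F_def c_def weight_nonneg\<close>)
  then have "(F has_sum (c / (1 - r) * (1 / 2 * gamma_summand (Suc k)))) ({1..} \<times> finsets k)"
    by (intro has_sum_SigmaI[OF _ outer] inner)
  also have "?this \<longleftrightarrow> ((\<lambda>x. weight (case x of (t, T) \<Rightarrow> insert t ((+) t ` T))) has_sum (c / (1 - r) * (1 / 2 * gamma_summand (Suc k)))) ({1..} \<times> finsets k)"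
    by (intro has_sum_cong) (auto simp: F_def weight_insert_shift c_def r_def finsets_def)
  also have "\<dots> \<longleftrightarrow> (weight has_sum (c / (1 - r) * (1 / 2 * gamma_summand (Suc k)))) (finsets (Suc k))"
    by (rule has_sum_reindex_bij_betw[OF bij_betw_finsets_Suc])
  also have "c / (1 - r) * (1 / 2 * gamma_summand (Suc k)) = 1 / 2 * gamma_summand (Suc (Suc k))"
  proof -
    define d :: real where "d = 2 ^ (k + 2)"
    have "d > 0" "c = (real k + 1) / d" "r = (real k + 3) / d"
      by (simp_all add: d_def c_def r_def power_one_over)
    moreover from this have "1 - r = (d - real k - 3) / d"
      by (simp add: field_simps)
    ultimately have "c / (1 - r) = (real k + 1) / (d - real k - 3)"
      by simp
    moreover have "gamma_summand (Suc (Suc k)) = gamma_summand (Suc k) * ((real k + 1) / (d - real k - 3))"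
      using gamma_summand_Suc[of "Suc k"] by (simp add: d_def algebra_simps)
    ultimately show ?thesis
      by (simp only: mult_ac)
  qed
  finally show ?case .
qed

section \<open>Convergence and tails of the series\<close>

lemma gamma_summand_pos: "gamma_summand t > 0"
proof -
  have bound: "2 ^ i - real i - 1 > 0" if i: "i \<ge> 2" for i :: nat
  proof -
    obtain k where k: "i = 2 + k"
      using i le_Suc_ex by blast
    have "(2::real) ^ i = 2 ^ (k + 2)" "real i = real k + 2"
      by (simp_all add: k power_add)
    then show ?thesis
      using power_two_ge[of k] by linarith
  qed
  have "(real i - 1) / (2 ^ i - real i - 1) > 0" if "i \<in> {2..t}" for i
    by (rule divide_pos_pos[OF _ bound]) (use that in auto)
  then show ?thesis
    unfolding gamma_summand_def by (rule prod_pos)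
qed

text \<open>The ratio of consecutive terms is at most \<open>1 / 2\<close> exactly when
  \<open>2 ^ (t + 1) \<ge> 3 * t + 2\<close>, which starts at \<open>t = 2\<close>; at
  \<open>t = 1\<close> the ratio is still 1.\<close>

lemma gamma_summand_Suc_le:
  assumes "t \<ge> 2"
  shows "gamma_summand (Suc t) \<le> gamma_summand t * (1 / 2)"
proof -
  have bound2: "8 * 2 ^ k \<ge> 3 * real k + 8" for k :: nat
    by (induction k) auto
  obtain k where k: "t = 2 + k"
    using assms le_Suc_ex by blast
  have bound: "2 ^ Suc t \<ge> 3 * real t + 2"
  proof -
    have "(2::real) ^ Suc t = 8 * 2 ^ k" "real t = real k + 2"
      by (simp_all add: k power_add)
    then show ?thesis
      using bound2[of k] by linarith
  qed
  have "gamma_summand (Suc t) = gamma_summand t * (real t / (2 ^ Suc t - real t - 2))"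
    using assms by (simp add: gamma_summand_Suc)
  also have "real t / (2 ^ Suc t - real t - 2) \<le> 1 / 2"
    using bound assms by (simp add: divide_le_eq)
  finally show ?thesis
    using gamma_summand_pos[of t] by simp
qed

lemma gamma_summand_add_le:
  assumes "m \<ge> 2"
  shows "gamma_summand (m + j) \<le> gamma_summand m * (1 / 2) ^ j"
proof (induction j)
  case (Suc j)
  then show ?case
    using gamma_summand_Suc_le[of "m + j"] assms by simp
qed simp

lemma summable_gamma_summand: "summable (\<lambda>j. gamma_summand (m + j))"
proof -
  have "summable (\<lambda>j. gamma_summand (2 + j))"
    by (rule summable_comparison_test'[of "\<lambda>j. gamma_summand 2 * (1 / 2) ^ j"])
      (use gamma_summand_add_le[of 2] gamma_summand_pos in \<open>auto simp: less_imp_le intro!: summable_mult summable_geometric\<close>)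
  then have "summable gamma_summand"
    using summable_iff_shift[of gamma_summand 2] by (simp add: add.commute)
  then show ?thesis
    using summable_iff_shift[of gamma_summand m] by (simp add: add.commute)
qed

lemma gamma_summand_tail_le:
  assumes "m \<ge> 2"
  shows "(\<Sum>j. gamma_summand (m + j)) \<le> 2 * gamma_summand m"
proof -
  have "(\<Sum>j. gamma_summand (m + j)) \<le> (\<Sum>j. gamma_summand m * (1 / 2) ^ j)"
    by (intro suminf_le summable_gamma_summand summable_mult summable_geometric gamma_summand_add_le assms) auto
  also have "\<dots> = gamma_summand m * 2"
    by (subst suminf_mult) (auto simp: suminf_geometric)
  finally show ?thesis
    by simp
qed

lemma has_sum_gamma_summand: "(gamma_summand has_sum (\<Sum>j. gamma_summand (m + j))) {m..}"
proof -
  have "((\<lambda>j. gamma_summand (m + j)) has_sum (\<Sum>j. gamma_summand (m + j))) UNIV"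
    by (intro sums_nonneg_imp_has_sum summable_sums summable_gamma_summand) (simp add: gamma_summand_pos less_imp_le)
  then show ?thesis
    by (subst has_sum_reindex_bij_witness[of _ "(+) m" "\<lambda>t. t - m" UNIV "\<lambda>j. gamma_summand (m + j)"]) auto
qed

lemma juggling_gamma_eq: "juggling_gamma = 1 / 2 + 1 / 2 * (\<Sum>j. gamma_summand (2 + j))"
proof -
  have "juggling_gamma = 1 / 2 + 1 / 2 * infsum gamma_summand {2..}"
    by (simp add: juggling_gamma_def gamma_summand_def[abs_def])
  then show ?thesis
    using infsumI[OF has_sum_gamma_summand[of 2]] by simp
qed

text \<open>Sets are grouped by cardinality. The empty set supplies the leading \<open>1 / 2\<close>
  of \<open>juggling_gamma\<close>, because \<open>gamma_summand 1\<close> is an empty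
  product.\<close>

lemma has_sum_weight: "(weight has_sum juggling_gamma) {T. finite T \<and> 0 \<notin> T}"
proof -
  have t1: "gamma_summand 1 = 1"
    by (simp add: gamma_summand_def)
  have "(\<Sum>j. gamma_summand (1 + j)) = (\<Sum>j. gamma_summand (1 + Suc j)) + gamma_summand 1"
    using suminf_split_head[OF summable_gamma_summand[of 1]] by simp
  then have "1 / 2 * (\<Sum>j. gamma_summand (1 + j)) = juggling_gamma"
    using t1 by (simp add: juggling_gamma_eq field_simps)
  moreover have "((\<lambda>k. 1 / 2 * gamma_summand (1 + k)) has_sum (1 / 2 * (\<Sum>j. gamma_summand (1 + j)))) UNIV"
    by (intro sums_nonneg_imp_has_sum sums_mult summable_sums summable_gamma_summand) (simp add: gamma_summand_pos less_imp_le)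
  moreover define g where "g k = 1 / 2 * gamma_summand (Suc k)" for k
  ultimately have outer: "(g has_sum juggling_gamma) UNIV"
    by (simp add: g_def[abs_def])
  define F where "F = (\<lambda>(k :: nat, T). weight T)"
  have inner: "((\<lambda>T. F (k, T)) has_sum g k) (finsets k)" for k
    using has_sum_weight_finsets by (simp add: F_def g_def)
  have "F summable_on Sigma UNIV finsets"
    by (intro summable_on_SigmaI[where g = g] inner)
      (use outer in \<open>auto simp: summable_on_def F_def weight_nonneg\<close>)
  then have "(F has_sum juggling_gamma) (Sigma UNIV finsets)"
    by (intro has_sum_SigmaI[OF _ outer] inner)
  then show ?thesis
    by (subst has_sum_reindex_bij_witness[of _ snd "\<lambda>T. (card T, T)" "Sigma UNIV finsets" F])
      (auto simp: F_def finsets_def)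
qed

text \<open>The terms with \<open>t\<close> from 2 to 14 are computed exactly; the rest lies between
  0 and twice its first term \<open>gamma_summand 15\<close>, which is small enough for both
  bounds.\<close>

lemma juggling_gamma_bounds:
  "1.3296387925905428331319 \<le> juggling_gamma" "juggling_gamma < 1.3296387925905428331320"
proof -
  have "(\<Sum>j. gamma_summand (2 + j)) = (\<Sum>j. gamma_summand (2 + (j + 13))) + (\<Sum>j<13. gamma_summand (2 + j))"
    by (rule suminf_split_initial_segment[OF summable_gamma_summand])
  also have "(\<lambda>j. gamma_summand (2 + (j + 13))) = (\<lambda>j. gamma_summand (15 + j))"
    by (intro ext arg_cong[of _ _ gamma_summand]) simp
  finally have split: "(\<Sum>j. gamma_summand (2 + j)) = (\<Sum>j. gamma_summand (15 + j)) + (\<Sum>j<13. gamma_summand (2 + j))" .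
  note rec = gamma_summand_Suc
  have t2: "gamma_summand 2 = 1" by (simp add: gamma_summand_def)
  have tail: "0 \<le> (\<Sum>j. gamma_summand (15 + j))" "(\<Sum>j. gamma_summand (15 + j)) \<le> 2 * gamma_summand 15"
    using gamma_summand_tail_le[of 15] by (auto intro!: suminf_nonneg summable_gamma_summand simp: gamma_summand_pos less_imp_le)
  have t3: "gamma_summand 3 = 1 / 2" using rec[of 2] t2 by simp
  have t4: "gamma_summand 4 = 3 / 22" using rec[of 3] t3 by simp
  have t5: "gamma_summand 5 = 3 / 143" using rec[of 4] t4 by simp
  have t6: "gamma_summand 6 = gamma_summand 5 * (5 / 57)" using rec[of 5] by simp
  have t7: "gamma_summand 7 = gamma_summand 6 * (6 / 120)" using rec[of 6] by simp
  have t8: "gamma_summand 8 = gamma_summand 7 * (7 / 247)" using rec[of 7] by simp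
  have t9: "gamma_summand 9 = gamma_summand 8 * (8 / 502)" using rec[of 8] by simp
  have t10: "gamma_summand 10 = gamma_summand 9 * (9 / 1013)" using rec[of 9] by simp
  have t11: "gamma_summand 11 = gamma_summand 10 * (10 / 2036)" using rec[of 10] by simp
  have t12: "gamma_summand 12 = gamma_summand 11 * (11 / 4083)" using rec[of 11] by simp
  have t13: "gamma_summand 13 = gamma_summand 12 * (12 / 8178)" using rec[of 12] by simp
  have t14: "gamma_summand 14 = gamma_summand 13 * (13 / 16369)" using rec[of 13] by simp
  have t15: "gamma_summand 15 = gamma_summand 14 * (14 / 32752)" using rec[of 14] by simp
  note ts = t2 t3 t4 t5 t6 t7 t8 t9 t10 t11 t12 t13 t14 t15
  have "(\<Sum>j<13. gamma_summand (2 + j)) = gamma_summand 2 + gamma_summand 3 + gamma_summand 4 + gamma_summand 5 + gamma_summand 6 + gamma_summand 7 + gamma_summand 8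
      + gamma_summand 9 + gamma_summand 10 + gamma_summand 11 + gamma_summand 12 + gamma_summand 13 + gamma_summand 14"
    by (simp add: eval_nat_numeral)
  then show "1.3296387925905428331319 \<le> juggling_gamma" "juggling_gamma < 1.3296387925905428331320"
    using tail unfolding juggling_gamma_eq split ts by simp_all
qed

section \<open>Counting arrangements of gaps\<close>

fun valid_marks :: "nat \<Rightarrow> (nat \<times> bool) list \<Rightarrow> bool" where
  "valid_marks b [] \<longleftrightarrow> True"
| "valid_marks b ((c, m) # l) \<longleftrightarrow> (m \<longrightarrow> c < b) \<and> valid_marks c l"

text \<open>
  In a list of gaps, \<open>True\<close> means marked. The largest gap \<open>h\<close> precedes the first entry and is not
  part of the list.
\<close>

definition configs :: "nat \<Rightarrow> nat \<Rightarrow> nat set \<Rightarrow> (nat \<times> bool) list set" where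
  "configs h e T = {l. valid_marks h l \<and> distinct (map fst l) \<and> fst ` set l \<subseteq> {e..<h} \<and> {c. (c, False) \<in> set l} = T}"

lemma valid_marks_append: "valid_marks b (xs @ ys) \<longleftrightarrow> valid_marks b xs \<and> valid_marks (last (b # map fst xs)) ys"
  by (induction b xs rule: valid_marks.induct) auto

text \<open>A smallest gap \<open>e\<close> lies below its predecessor, so its own mark is always
  allowed. Its successor exceeds \<open>e\<close> and must be unmarked, and before an unmarked gap
  the predecessor is irrelevant.\<close>

lemma valid_marks_insert_min:
  assumes "e < h" "\<And>c m. (c, m) \<in> set xs \<union> set ys \<Longrightarrow> e < c"
  shows "valid_marks h (xs @ (e, m) # ys) \<longleftrightarrow> valid_marks h (xs @ ys) \<and> (ys = [] \<or> \<not> snd (hd ys))"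
proof -
  have "last (h # map fst xs) \<in> insert h (fst ` set xs)"
    by (cases xs rule: rev_cases) auto
  then have "e < last (h # map fst xs)"
    using assms by fastforce
  moreover have "valid_marks e ys \<longleftrightarrow> valid_marks b ys \<and> (ys = [] \<or> \<not> snd (hd ys))" for b
  proof (cases ys)
    case (Cons p zs)
    then have "e < fst p"
      using assms(2)[of "fst p" "snd p"] by simp
    then show ?thesis
      by (cases p) (auto simp: Cons)
  qed simp
  ultimately show ?thesis
    by (auto simp: valid_marks_append)
qed

lemma finite_configs: "finite (configs h e T)"
proof (rule finite_subset)
  show "configs h e T \<subseteq> {l. set l \<subseteq> {..<h} \<times> UNIV \<and> distinct l}"
    by (auto simp: configs_def distinct_map)
qed (simp add: finite_subset_distinct)

lemma configs_le:
  assumes "l \<in> configs h e T" "(c, m) \<in> set l"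
  shows "e \<le> c"
proof -
  have "c \<in> fst ` set l"
    using assms(2) by force
  then show ?thesis
    using assms(1) by (auto simp: configs_def)
qed

text \<open>The positions at which a new smallest gap may be inserted.\<close>

definition chain_ends :: "(nat \<times> bool) list \<Rightarrow> nat set" where
  "chain_ends l = {i. i \<le> length l \<and> (i < length l \<longrightarrow> \<not> snd (l ! i))}"

lemma chain_ends_append: "length xs \<in> chain_ends (xs @ ys) \<longleftrightarrow> ys = [] \<or> \<not> snd (hd ys)"
  by (cases ys) (auto simp: chain_ends_def nth_append)

text \<open>There is one place before each unmarked entry and one at the end; as the gaps are
  distinct, the unmarked entries are counted by \<open>T\<close>.\<close>

lemma card_chain_ends:
  assumes "l \<in> configs h e T"
  shows "card (chain_ends l) = card T + 1"
proof -
  have "chain_ends l = insert (length l) {i. i < length l \<and> \<not> snd (l ! i)}"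
    by (auto simp: chain_ends_def)
  then have "card (chain_ends l) = length (filter (\<lambda>p. \<not> snd p) l) + 1"
    by (simp add: length_filter_conv_card)
  also have "length (filter (\<lambda>p. \<not> snd p) l) = card (set (map fst (filter (\<lambda>p. \<not> snd p) l)))"
    using assms by (subst distinct_card) (auto simp: configs_def distinct_map_filter)
  also have "set (map fst (filter (\<lambda>p. \<not> snd p) l)) = T"
    using assms by (force simp: configs_def)
  finally show ?thesis .
qed

text \<open>Lists containing \<open>(e, m)\<close> correspond to pairs of a list of larger gaps and
  a chain end of it. The pair is recovered by cutting at the only occurrence of
  \<open>e\<close>.\<close>

lemma card_configs_insert_min:
  assumes "e < h" "T \<subseteq> {e<..<h}"
  shows "card {l \<in> configs h e (if m then T else insert e T). (e, m) \<in> set l} =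
    card (configs h (Suc e) T) * (card T + 1)"
proof -
  define ins where "ins = (\<lambda>(l, i). take i l @ (e, m) # drop i l)"
  let ?S = "SIGMA l:configs h (Suc e) T. chain_ends l"
  let ?C = "{l \<in> configs h e (if m then T else insert e T). (e, m) \<in> set l}"
  have notin: "(e, m') \<notin> set l" if "l \<in> configs h (Suc e) T" for l m'
    using configs_le[OF that, of e m'] by auto
  \<comment> \<open>Read from right to left this shows that insertion lands in \<open>?C\<close>,
    from left to right that it reaches all of \<open>?C\<close>.\<close>
  have char: "xs @ (e, m) # ys \<in> ?C \<longleftrightarrow> xs @ ys \<in> configs h (Suc e) T \<and> length xs \<in> chain_ends (xs @ ys)"
    for xs ys
  proof -
    have "{Suc e..<h} = {e..<h} - {e}"
      by auto
    then have vals: "fst ` set (xs @ ys) \<subseteq> {Suc e..<h} \<longleftrightarrow>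
        e \<notin> fst ` set xs \<union> fst ` set ys \<and> fst ` set (xs @ ys) \<subseteq> {e..<h}"
      by (simp only: set_append image_Un) blast
    have heads: "{c. (c, False) \<in> set (xs @ (e, m) # ys)} = (if m then T else insert e T)
        \<longleftrightarrow> {c. (c, False) \<in> set (xs @ ys)} = T" if A: "fst ` set (xs @ ys) \<subseteq> {Suc e..<h}"
    proof -
      have "e \<notin> {c. (c, False) \<in> set (xs @ ys)}"
        using A unfolding vals by (auto simp: image_iff)
      moreover have "e \<notin> T"
        using assms(2) by auto
      moreover have "{c. (c, False) \<in> set (xs @ (e, m) # ys)} =
        (if m then {c. (c, False) \<in> set (xs @ ys)} else insert e {c. (c, False) \<in> set (xs @ ys)})"
        by auto
      ultimately show ?thesis
        by (cases m) (simp_all only: insert_ident if_True if_False not_False_eq_True)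
    qed
    have valid_marks: "valid_marks h (xs @ (e, m) # ys) \<longleftrightarrow> valid_marks h (xs @ ys) \<and> (ys = [] \<or> \<not> snd (hd ys))"
      if A: "fst ` set (xs @ ys) \<subseteq> {Suc e..<h}"
    proof (rule valid_marks_insert_min[OF assms(1)])
      fix c m assume "(c, m) \<in> set xs \<union> set ys"
      then have "c \<in> fst ` set (xs @ ys)"
        by force
      then show "e < c"
        using A by auto
    qed
    have mem: "xs @ (e, m) # ys \<in> configs h e (if m then T else insert e T) \<longleftrightarrow> valid_marks h (xs @ (e, m) # ys) \<and>
        distinct (map fst (xs @ (e, m) # ys)) \<and> fst ` set (xs @ (e, m) # ys) \<subseteq> {e..<h} \<and>
        {c. (c, False) \<in> set (xs @ (e, m) # ys)} = (if m then T else insert e T)"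
      unfolding configs_def mem_Collect_eq ..
    have dist: "distinct (map fst (xs @ (e, m) # ys)) \<longleftrightarrow>
        distinct (map fst (xs @ ys)) \<and> e \<notin> fst ` set xs \<union> fst ` set ys"
      by auto
    have range: "fst ` set (xs @ (e, m) # ys) \<subseteq> {e..<h} \<longleftrightarrow> fst ` set (xs @ ys) \<subseteq> {e..<h}"
      using assms(1) by auto
    have ins: "(e, m) \<in> set (xs @ (e, m) # ys) \<longleftrightarrow> True"
      by simp
    have "xs @ (e, m) # ys \<in> ?C \<longleftrightarrow> valid_marks h (xs @ (e, m) # ys) \<and>
        (distinct (map fst (xs @ ys)) \<and> e \<notin> fst ` set xs \<union> fst ` set ys) \<and>
        fst ` set (xs @ ys) \<subseteq> {e..<h} \<and>
        {c. (c, False) \<in> set (xs @ (e, m) # ys)} = (if m then T else insert e T)"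
      unfolding mem_Collect_eq mem dist range ins by (rule simp_thms)
    also have "\<dots> \<longleftrightarrow> (valid_marks h (xs @ ys) \<and> distinct (map fst (xs @ ys)) \<and>
        fst ` set (xs @ ys) \<subseteq> {Suc e..<h} \<and> {c. (c, False) \<in> set (xs @ ys)} = T) \<and>
        (ys = [] \<or> \<not> snd (hd ys))"
    proof (cases "fst ` set (xs @ ys) \<subseteq> {Suc e..<h}")
      case True
      show ?thesis
        unfolding heads[OF True] valid_marks[OF True] using True vals by metis
    next
      case False
      then show ?thesis
        using vals by metis
    qed
    also have "\<dots> \<longleftrightarrow> xs @ ys \<in> configs h (Suc e) T \<and> length xs \<in> chain_ends (xs @ ys)"
      unfolding configs_def mem_Collect_eq chain_ends_append ..
    finally show ?thesis .
  qed
  have "inj_on ins ?S"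
  proof (rule inj_onI, clarify)
    fix l i l' i'
    assume l: "l \<in> configs h (Suc e) T" "i \<in> chain_ends l"
      and l': "l' \<in> configs h (Suc e) T" "i' \<in> chain_ends l'"
      and eq: "ins (l, i) = ins (l', i')"
    have "(e, m) \<notin> set (take i l)" "(e, m) \<notin> set (drop i l)"
      "(e, m) \<notin> set (take i' l')" "(e, m) \<notin> set (drop i' l')"
      using notin[OF l(1), of m] notin[OF l'(1), of m] by (auto dest: in_set_takeD in_set_dropD)
    then have *: "take i l = take i' l'" "drop i l = drop i' l'"
      using append_Cons_eq_iff[of "(e, m)" "take i l" "drop i l" "take i' l'" "drop i' l'"]
        eq[unfolded ins_def prod.case] by blast+
    have "l = take i l @ drop i l"
      by simp
    also have "\<dots> = take i' l' @ drop i' l'"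
      by (simp only: *)
    also have "\<dots> = l'"
      by simp
    finally have "l = l'" .
    moreover have "i = i'"
      using arg_cong[OF *(1), of length] l(2) l'(2) by (simp add: chain_ends_def)
    ultimately show "l = l' \<and> i = i'" ..
  qed
  moreover have "ins ` ?S = ?C"
  proof (intro equalityI subsetI)
    fix L assume "L \<in> ins ` ?S"
    then obtain l i where li: "l \<in> configs h (Suc e) T" "i \<in> chain_ends l" "L = ins (l, i)"
      by auto
    have "length (take i l) = i"
      using li(2) by (simp add: chain_ends_def)
    then have "take i l @ (e, m) # drop i l \<in> ?C"
      unfolding char using li(1,2) by simp
    then show "L \<in> ?C"
      using li(3) by (simp only: ins_def prod.case)
  next
    fix L assume L: "L \<in> ?C"
    then have "(e, m) \<in> set L"
      by blast
    then obtain xs ys where eq: "L = xs @ (e, m) # ys"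
      using split_list by metis
    have "xs @ ys \<in> configs h (Suc e) T \<and> length xs \<in> chain_ends (xs @ ys)"
      using L unfolding eq char .
    then show "L \<in> ins ` ?S"
      by (intro image_eqI[of _ _ "(xs @ ys, length xs)"]) (simp_all add: ins_def eq)
  qed
  ultimately have "card ?C = card ?S"
    using card_image[of ins ?S] by simp
  also have "\<dots> = (\<Sum>l\<in>configs h (Suc e) T. card (chain_ends l))"
    by (rule card_SigmaI) (auto simp: finite_configs chain_ends_def)
  also have "\<dots> = card (configs h (Suc e) T) * (card T + 1)"
    by (simp add: card_chain_ends)
  finally show ?thesis .
qed

text \<open>Downward induction on the lower bound \<open>e\<close>. If \<open>e \<in> T\<close>, it
  occurs unmarked at one of \<open>card T\<close> places, which builds up the factorial. Otherwise
  it is absent or marked at one of \<open>card T + 1\<close> places, giving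
  \<open>card T + 2\<close> choices.\<close>

lemma card_configs:
  assumes "e \<le> h" "T \<subseteq> {e..<h}"
  shows "card (configs h e T) =
    fact (card T) * (\<Prod>c = e..<h. if c \<in> T then 1 else 2 + card {t \<in> T. c < t})"
  using assms
proof (induction arbitrary: T rule: inc_induct)
  case base
  then have "configs h h T = {[]}"
    by (auto simp: configs_def)
  then show ?case
    using base by simp
next
  case (step e)
  define T' where "T' = T - {e}"
  have T': "T' \<subseteq> {e<..<h}" "T' \<subseteq> {Suc e..<h}"
    using step.prems by (auto simp: T'_def le_less)
  then have "finite T'"
    by (meson finite_greaterThanLessThan finite_subset)
  define p where "p T = (\<Prod>c = Suc e..<h. if c \<in> T then 1 else 2 + card {t \<in> T. c < t})" for T
  \<comment> \<open>Only numbers above \<open>e\<close> enter \<open>p\<close>, and for them the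
    presence of \<open>e\<close> in \<open>T\<close> makes no difference.\<close>
  have pT: "p T = p T'"
  proof -
    have "{t \<in> T. c < t} = {t \<in> T'. c < t}" if "c \<in> {Suc e..<h}" for c
      using that by (auto simp: T'_def)
    then show ?thesis
      unfolding p_def by (intro prod.cong) (auto simp: T'_def)
  qed
  have IH: "card (configs h (Suc e) T') = fact (card T') * p T'"
    using step.IH[OF T'(2)] by (simp add: p_def)
  have prod: "(\<Prod>c = e..<h. if c \<in> T then 1 else 2 + card {t \<in> T. c < t}) =
      (if e \<in> T then 1 else 2 + card {t \<in> T. e < t}) * p T"
    unfolding p_def using step.hyps by (simp add: prod.atLeast_Suc_lessThan)
  show ?case
  proof (cases "e \<in> T")
    case True
    then have T: "T = insert e T'"
      by (auto simp: T'_def)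
    then have "(e, False) \<in> set l" if "l \<in> configs h e T" for l
      using that by (auto simp: configs_def)
    then have "configs h e T = {l \<in> configs h e (if False then T' else insert e T'). (e, False) \<in> set l}"
      using T by auto
    then have "card (configs h e T) = card (configs h (Suc e) T') * (card T' + 1)"
      using card_configs_insert_min[OF step.hyps(2) T'(1), of False] by simp
    moreover have "card T = Suc (card T')"
      by (subst T, rule card_insert_disjoint[OF \<open>finite T'\<close>]) (simp add: T'_def)
    ultimately show ?thesis
      using True by (simp add: IH prod pT algebra_simps)
  next
    case False
    then have T: "T' = T"
      by (simp add: T'_def)
    have eq: "configs h e T = configs h (Suc e) T \<union> {l \<in> configs h e (if True then T else insert e T). (e, True) \<in> set l}"
      (is "_ = _ \<union> ?C")
    proof -
      have "l \<in> configs h (Suc e) T" if l: "l \<in> configs h e T" "(e, True) \<notin> set l" for l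
      proof -
        have "(e, m) \<notin> set l" for m
          using l False by (cases m) (auto simp: configs_def)
        then have "e \<notin> fst ` set l"
          by auto
        moreover have "{Suc e..<h} = {e..<h} - {e}"
          by auto
        ultimately have "fst ` set l \<subseteq> {Suc e..<h}"
          using l by (simp add: configs_def subset_Diff_insert)
        then show ?thesis
          using l by (simp add: configs_def)
      qed
      moreover have "l \<in> configs h e T" if "l \<in> configs h (Suc e) T" for l
        using that subset_trans[of "fst ` set l" "{Suc e..<h}" "{e..<h}"] by (simp add: configs_def)
      ultimately show ?thesis
        by auto
    qed
    have "card (configs h e T) = card (configs h (Suc e) T) + card ?C"
      unfolding eq
    proof (rule card_Un_disjoint)
      show "configs h (Suc e) T \<inter> ?C = {}"
        using configs_le[of _ h "Suc e" T e True] by auto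
    qed (auto simp: finite_configs)
    also have "card ?C = card (configs h (Suc e) T) * (card T + 1)"
      using card_configs_insert_min[OF step.hyps(2) T'(1), of True] T by simp
    finally have "card (configs h e T) = card (configs h (Suc e) T) * (card T + 2)"
      by simp
    moreover have "{t \<in> T. e < t} = T"
      using T' T by auto
    ultimately show ?thesis
      using False T IH by (simp add: prod algebra_simps)
  qed
qed

text \<open>Halving each of the \<open>h - 1\<close> factors of the count gives the values of
  \<open>factor\<close>; the constant \<open>1 / 2\<close> in \<open>weight\<close> completes the
  power to \<open>2 ^ h\<close>.\<close>

lemma card_configs_eq_weight:
  assumes "T \<subseteq> {1..<h}" "1 \<le> h"
  shows "real (card (configs h 1 T)) = weight T * 2 ^ (h + \<Sum>T)"
proof -
  have fin: "finite T"
    using assms by (meson finite_atLeastLessThan finite_subset)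
  have "{1..h - 1} = {1..<h}"
    using assms by auto
  then have "weight T = 1 / 2 * fact (card T) * (1 / 2) ^ (\<Sum>T) * (\<Prod>e = 1..<h. factor T e)"
    using weight_eq[OF fin, of "h - 1"] assms by fastforce
  also have "(\<Prod>e = 1..<h. factor T e) =
      (\<Prod>e = 1..<h. 1 / 2 * real (if e \<in> T then 1 else 2 + card {t \<in> T. e < t}))"
    by (intro prod.cong) (auto simp: factor_def field_simps)
  also have "\<dots> = (1 / 2) ^ (h - 1) * real (\<Prod>e = 1..<h. if e \<in> T then 1 else 2 + card {t \<in> T. e < t})"
    by (subst prod.distrib) (simp only: prod_constant card_atLeastLessThan of_nat_prod)
  finally show ?thesis
    using card_configs[OF assms(2,1)] assms(2)
    by (cases h) (simp_all add: power_add power_one_over)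
qed

section \<open>Cycles as closed walks\<close>

text \<open>Only pairs with positive second component stand for two-ball states; for gap 0 the two
  positions coincide.\<close>

definition state :: "nat \<times> nat \<Rightarrow> nat \<Rightarrow> nat" where
  "state v = (\<lambda>i. if i = fst v \<or> i = fst v + snd v then 1 else 0)"

text \<open>When a ball is at position 0, the other one moves down by one and becomes the lower ball
  of \<open>v\<close> in the first disjunct (unmarked), the upper ball in the second
  (marked).\<close>

definition step :: "nat \<times> nat \<Rightarrow> nat \<times> nat \<Rightarrow> bool" where
  "step u v \<longleftrightarrow> (if fst u = 0 then snd u = Suc (fst v) \<or> snd u = Suc (fst v + snd v)
    else fst u = Suc (fst v) \<and> snd v = snd u)"

fun walk :: "nat \<times> nat \<Rightarrow> (nat \<times> nat) list \<Rightarrow> bool" where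
  "walk u [] \<longleftrightarrow> True"
| "walk u (v # w) \<longleftrightarrow> 1 \<le> snd v \<and> step u v \<and> walk v w"

fun walk_arcs :: "nat \<times> nat \<Rightarrow> (nat \<times> nat) list \<Rightarrow> ((nat \<Rightarrow> nat) \<times> (nat \<Rightarrow> nat)) list" where
  "walk_arcs u [] = []"
| "walk_arcs u (v # w) = (state u, state v) # walk_arcs v w"

section \<open>Two-ball states and their arcs in coordinates\<close>

lemma state_eq_1_iff: "state v i = 1 \<longleftrightarrow> i = fst v \<or> i = fst v + snd v"
  by (simp add: state_def)

lemma support_state: "{j. state v j = 1} = {fst v, fst v + snd v}"
  by (simp only: state_eq_1_iff) blast

lemma state_inject:
  assumes "state u = state v" "1 \<le> snd u" "1 \<le> snd v"
  shows "u = v"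
proof -
  have "{fst u, fst u + snd u} = {fst v, fst v + snd v}"
    using assms(1) by (metis support_state)
  then show ?thesis
    using assms(2,3) by (auto simp: doubleton_eq_iff prod_eq_iff)
qed

lemma states_2: "states 2 = state ` {v. 1 \<le> snd v}"
proof (intro equalityI subsetI)
  fix c assume "c \<in> states 2"
  then have c: "range c \<subseteq> {0, 1}" "card {j. c j = 1} = 2"
    by (auto simp: states_def)
  then obtain a b where ab: "{j. c j = 1} = {a, b}" "a < b"
  proof -
    obtain a b where ab: "{j. c j = 1} = {a, b}" "a \<noteq> b"
      using c(2) by (metis card_2_iff)
    then consider "a < b" | "b < a"
      by linarith
    then show thesis
      using that[of a b] that[of b a] ab(1) by cases (auto simp: insert_commute)
  qed
  have "c j = state (a, b - a) j" for j
  proof -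
    have "c j = 0 \<or> c j = 1"
      using c(1) by auto
    moreover have "c j = 1 \<longleftrightarrow> j = a \<or> j = b"
      using ab(1) by blast
    ultimately show ?thesis
      using ab(2) by (auto simp: state_def)
  qed
  then have "c = state (a, b - a)"
    by (rule ext)
  then show "c \<in> state ` {v. 1 \<le> snd v}"
    using ab(2) by auto
next
  fix c assume "c \<in> state ` {v. 1 \<le> snd v}"
  then obtain v where v: "c = state v" "1 \<le> snd v"
    by auto
  have "range (state v) \<subseteq> {0, 1}"
    by (auto simp: state_def)
  then show "c \<in> states 2"
    using v unfolding states_def mem_Collect_eq support_state v(1) by simp
qed

text \<open>An arc asks that every ball of \<open>u\<close> not at position 0 reappear one position
  lower. This prescribes one ball of \<open>v\<close> if \<open>fst u = 0\<close>, and both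
  otherwise.\<close>

lemma parcs_state_graph:
  assumes "1 \<le> snd u" "1 \<le> snd v"
  shows "(state u, state v) \<in> parcs (state_graph 2) \<longleftrightarrow> step u v"
proof -
  have "(state u, state v) \<in> parcs (state_graph 2) \<longleftrightarrow> (\<forall>i. state v i \<ge> state u (Suc i))"
    using assms by (simp add: state_graph_def states_2)
  also have "\<dots> \<longleftrightarrow> (\<forall>i. Suc i = fst u \<or> Suc i = fst u + snd u \<longrightarrow> i = fst v \<or> i = fst v + snd v)"
    by (auto simp: state_def)
  also have "\<dots> \<longleftrightarrow> step u v"
  proof (cases "fst u")
    case 0
    then show ?thesis
      using assms by (cases "snd u") (auto simp: step_def)
  next
    case (Suc x)
    then have "(\<forall>i. Suc i = fst u \<or> Suc i = fst u + snd u \<longrightarrow> i = fst v \<or> i = fst v + snd v) \<longleftrightarrow>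
        (x = fst v \<or> x = fst v + snd v) \<and> (x + snd u = fst v \<or> x + snd u = fst v + snd v)"
      by auto
    also have "\<dots> \<longleftrightarrow> step u v"
      using assms Suc by (auto simp: step_def)
    finally show ?thesis .
  qed
  finally show ?thesis .
qed

lemma walk_append: "walk u (xs @ ys) \<longleftrightarrow> walk u xs \<and> walk (last (u # xs)) ys"
  by (induction u xs rule: walk.induct) auto

lemma walk_arcs_append: "walk_arcs u (xs @ ys) = walk_arcs u xs @ walk_arcs (last (u # xs)) ys"
  by (induction u xs rule: walk_arcs.induct) auto

lemma map_snd_walk_arcs: "map snd (walk_arcs u w) = map state w"
  by (induction u w rule: walk_arcs.induct) auto

lemma length_walk_arcs [simp]: "length (walk_arcs u w) = length w"
  by (induction u w rule: walk_arcs.induct) auto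

lemma walk_snd_pos: "walk u w \<Longrightarrow> v \<in> set w \<Longrightarrow> 1 \<le> snd v"
  by (induction u w rule: walk.induct) auto

lemma inj_on_state: "inj_on state {v. 1 \<le> snd v}"
  by (intro inj_onI state_inject) auto

lemma walk_arcs_inject:
  assumes "walk_arcs u w = walk_arcs u' w'" "walk u w" "walk u' w'"
  shows "w = w'"
proof (rule map_inj_on)
  show "map state w = map state w'"
    using assms(1) by (metis map_snd_walk_arcs)
  show "inj_on state (set w \<union> set w')"
    by (rule inj_on_subset[OF inj_on_state]) (use walk_snd_pos[OF assms(2)] walk_snd_pos[OF assms(3)] in auto)
qed

text \<open>Translates walks given by arcs into lists of pairs: the head of each arc is a two-ball
  state and hence has coordinates.\<close>

lemma pcas_iff_walk_arcs:
  assumes "1 \<le> snd u"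
  shows "set p \<subseteq> parcs (state_graph 2) \<and> pcas (state u) p z \<longleftrightarrow>
    (\<exists>w. walk u w \<and> p = walk_arcs u w \<and> z = state (last (u # w)))"
  using assms
proof (induction p arbitrary: u)
  case Nil
  have "p = walk_arcs u w \<and> p = [] \<longleftrightarrow> w = [] \<and> p = []" for p w
    by (cases w) auto
  then show ?case
    by (metis last.simps list.set(1) empty_subsetI pcas.simps(1) walk.simps(1) walk_arcs.simps(1))
next
  case (Cons a p)
  show ?case
  proof
    assume L: "set (a # p) \<subseteq> parcs (state_graph 2) \<and> pcas (state u) (a # p) z"
    then have a: "a \<in> parcs (state_graph 2)" "fst a = state u" "pcas (snd a) p z"
      by auto
    then have "snd a \<in> states 2"
      by (auto simp: state_graph_def)
    then obtain v where v: "snd a = state v" "1 \<le> snd v"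
      by (auto simp: states_2)
    have "a = (state u, state v)"
      using a v by (simp add: prod_eq_iff)
    then have "step u v"
      using a(1) parcs_state_graph[OF Cons.prems v(2)] by simp
    moreover obtain w where "walk v w" "p = walk_arcs v w" "z = state (last (v # w))"
      using Cons.IH[OF v(2)] L v(1) by auto
    ultimately show "\<exists>w. walk u w \<and> a # p = walk_arcs u w \<and> z = state (last (u # w))"
      using v(2) \<open>a = (state u, state v)\<close> by (intro exI[of _ "v # w"]) auto
  next
    assume "\<exists>w. walk u w \<and> a # p = walk_arcs u w \<and> z = state (last (u # w))"
    then obtain w where w: "walk u w" "a # p = walk_arcs u w" "z = state (last (u # w))"
      by blast
    then obtain v w' where vw: "w = v # w'"
      by (cases w) auto
    then have "set p \<subseteq> parcs (state_graph 2) \<and> pcas (state v) p z"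
      using w Cons.IH[of v] by auto
    moreover have "a = (state u, state v)" "a \<in> parcs (state_graph 2)"
      using w vw Cons.prems by (auto simp: parcs_state_graph)
    ultimately show "set (a # p) \<subseteq> parcs (state_graph 2) \<and> pcas (state u) (a # p) z"
      by simp
  qed
qed

lemma pawalk_verts_eq: "pcas u p v \<Longrightarrow> pawalk_verts u p = u # map snd p"
  by (induction p arbitrary: u) auto

text \<open>The walk starts at \<open>last w\<close>, so \<open>w\<close> lists every vertex of the
  cycle once and the base point is its final entry.\<close>

definition closed_walks :: "nat \<Rightarrow> (nat \<times> nat) list set" where
  "closed_walks n = {w. w \<noteq> [] \<and> length w = n \<and> distinct w \<and> walk (last w) w}"

definition cycle_of :: "(nat \<times> nat) list \<Rightarrow> ((nat \<Rightarrow> nat) \<times> (nat \<Rightarrow> nat)) list" where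
  "cycle_of w = walk_arcs (last w) w"

text \<open>A cycle must have distinct vertices after the first one; these are the heads of its
  arcs, that is, the states listed in \<open>w\<close>. Injectivity of \<open>state\<close>
  identifies the base point with \<open>last w\<close>.\<close>

lemma cycles_of_length_eq: "cycles_of_length n 2 = cycle_of ` closed_walks n"
proof (intro equalityI subsetI)
  fix p assume "p \<in> cycles_of_length n 2"
  then obtain z where z: "z \<in> states 2" "set p \<subseteq> parcs (state_graph 2)" "pcas z p z"
      "distinct (tl (pawalk_verts z p))" "p \<noteq> []" "length p = n"
    by (auto simp: cycles_of_length_def pre_digraph.cycle_def pre_digraph.awalk_def
        cas_with_proj_eq awalk_verts_with_proj_eq state_graph_def)
  obtain u where u: "z = state u" "1 \<le> snd u"
    using z(1) by (auto simp: states_2)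
  then obtain w where w: "walk u w" "p = walk_arcs u w" "state u = state (last (u # w))"
    using pcas_iff_walk_arcs[of u p z] z by auto
  have "w \<noteq> []"
    using z(5) w(2) by auto
  have "1 \<le> snd (last w)"
    using walk_snd_pos[OF w(1)] \<open>w \<noteq> []\<close> by simp
  then have "u = last w"
    using w(3) u(2) \<open>w \<noteq> []\<close> by (intro state_inject) auto
  moreover have "distinct w"
    using z(3,4) w(2) by (simp add: pawalk_verts_eq map_snd_walk_arcs distinct_map)
  moreover have "length w = n"
    using z(6) w(2) by simp
  ultimately show "p \<in> cycle_of ` closed_walks n"
    using w \<open>w \<noteq> []\<close> by (auto simp: closed_walks_def cycle_of_def)
next
  fix p assume "p \<in> cycle_of ` closed_walks n"
  then obtain w where w: "p = cycle_of w" "w \<noteq> []" "length w = n" "distinct w" "walk (last w) w"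
    by (auto simp: closed_walks_def)
  have pos: "1 \<le> snd (last w)"
    using walk_snd_pos[OF w(5)] w(2) by simp
  then have p: "set p \<subseteq> parcs (state_graph 2) \<and> pcas (state (last w)) p (state (last w))"
    using w(1,2,5) by (subst pcas_iff_walk_arcs) (auto simp: cycle_of_def)
  have "set w \<subseteq> {v. 1 \<le> snd v}"
    using walk_snd_pos[OF w(5)] by auto
  then have "distinct (map snd p)"
    using w(1,4) inj_on_subset[OF inj_on_state] by (simp add: cycle_of_def map_snd_walk_arcs distinct_map)
  then have "distinct (tl (pawalk_verts (state (last w)) p))"
    using p pawalk_verts_eq[of "state (last w)" p "state (last w)"] by simp
  moreover have "state (last w) \<in> states 2"
    using pos by (simp add: states_2)
  moreover have "p \<noteq> []" "length p = n"
    using w(1,2,3) by (auto simp: cycle_of_def neq_Nil_conv)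
  ultimately show "p \<in> cycles_of_length n 2"
    unfolding cycles_of_length_def pre_digraph.cycle_def pre_digraph.awalk_def
      cas_with_proj_eq awalk_verts_with_proj_eq with_proj_simps mem_Collect_eq
    using p by (auto simp: state_graph_def)
qed

lemma cycle_of_inject:
  assumes "w \<in> closed_walks n" "w' \<in> closed_walks m" "cycle_of w = cycle_of w'"
  shows "w = w'"
  using assms walk_arcs_inject unfolding closed_walks_def cycle_of_def by blast

lemma cycle_of_rotate: "w \<noteq> [] \<Longrightarrow> cycle_of (rotate k w) = rotate k (cycle_of w)"
proof (induction k)
  case (Suc k)
  obtain v w' where vw: "rotate k w = v # w'"
    using Suc.prems by (metis list.exhaust rotate_is_Nil_conv)
  have "cycle_of (rotate1 (v # w')) = rotate1 (cycle_of (v # w'))"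
    by (simp add: cycle_of_def walk_arcs_append)
  then show ?case
    using Suc vw by simp
qed simp

lemma rotate_closed_walks: "w \<in> closed_walks n \<Longrightarrow> rotate k w \<in> closed_walks n"
proof (induction k)
  case (Suc k)
  have IH: "rotate k w \<in> closed_walks n"
    by (rule Suc.IH[OF Suc.prems])
  then obtain v w' where vw: "rotate k w = v # w'"
    by (cases "rotate k w") (auto simp: closed_walks_def)
  have "v # w' \<in> closed_walks n"
    using IH vw by simp
  then have "rotate1 (v # w') \<in> closed_walks n"
    by (auto simp: closed_walks_def walk_append)
  then show ?case
    using vw by simp
qed simp

section \<open>Cycles up to cyclic shift\<close>

lemma rotate_rotate_inverse: "\<exists>m. rotate m (rotate k xs) = xs"
proof (cases "xs = []")
  case False
  then have "(length xs - 1) * k + k = length xs * k"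
    by (cases xs) auto
  then show ?thesis
    by (intro exI[of _ "(length xs - 1) * k"]) (simp add: rotate_rotate rotate_id)
qed simp

lemma cyclic_shift_Image_rotate: "cyclic_shift `` {rotate k p} = cyclic_shift `` {p}"
proof -
  obtain m where m: "rotate m (rotate k p) = p"
    using rotate_rotate_inverse by blast
  have "\<exists>i. rotate j p = rotate i (rotate k p)" for j
    using m by (metis rotate_rotate)
  moreover have "\<exists>i. rotate j (rotate k p) = rotate i p" for j
    by (metis rotate_rotate)
  ultimately show ?thesis
    by (auto simp: cyclic_shift_def)
qed

lemma card_quotient_representatives:
  assumes "R \<subseteq> A" "\<And>x. x \<in> A \<Longrightarrow> \<exists>y\<in>R. r `` {x} = r `` {y}"
    and inj: "\<And>y y'. y \<in> R \<Longrightarrow> y' \<in> R \<Longrightarrow> r `` {y} = r `` {y'} \<Longrightarrow> y = y'"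
  shows "card (A // r) = card R"
proof -
  have "A // r = (\<lambda>y. r `` {y}) ` R"
    using assms(1,2) by (force simp: quotient_def)
  then show ?thesis
    using inj by (simp add: card_image inj_on_def)
qed

text \<open>
  Each cycle has exactly one rotation that ends in the state \<open>(0, h)\<close> with \<open>h\<close> its largest gap.
\<close>

definition canonical_walks :: "nat \<Rightarrow> (nat \<times> nat) list set" where
  "canonical_walks n = {w \<in> closed_walks n. \<exists>h. last w = (0, h) \<and> (\<forall>c. (0, c) \<in> set w \<longrightarrow> c \<le> h)}"

text \<open>Away from position 0 every step lowers the first component by exactly one, so a nonempty
  walk of this kind cannot close up.\<close>

lemma walk_without_landing:
  assumes "walk u w" "\<And>v. v \<in> set (u # w) \<Longrightarrow> fst v \<noteq> 0"
  shows "fst (last (u # w)) + length w = fst u"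
  using assms
proof (induction u w rule: walk.induct)
  case (2 u v w)
  then have "fst (last (v # w)) + length w = fst v"
    by simp
  moreover have "fst u = Suc (fst v)"
    using 2 by (auto simp: step_def split: if_splits)
  ultimately show ?case
    by simp
qed simp

text \<open>A nontrivial rotation ends with an element of a proper prefix of \<open>w\<close>, which
  by distinctness differs from the last element.\<close>

lemma rotate_same_last:
  assumes "distinct w" "last (rotate k w) = last w"
  shows "rotate k w = w"
proof (cases "k mod length w = 0")
  case True
  then show ?thesis
    by (rule rotate_id)
next
  case False
  define m where "m = k mod length w"
  show ?thesis
  proof (cases "w = []")
    case False
    then have "m < length w" "0 < m"
      using \<open>k mod length w \<noteq> 0\<close> by (simp_all add: m_def)
    then have ne: "take m w \<noteq> []" "drop m w \<noteq> []"
      by auto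
    have "last (rotate k w) = last (take m w)"
      using ne by (simp add: rotate_drop_take m_def)
    then have "last w \<in> set (take m w)"
      using assms(2) ne last_in_set by metis
    moreover have "last w \<in> set (drop m w)"
      using ne last_in_set last_drop \<open>m < length w\<close> by metis
    ultimately show ?thesis
      using set_take_disj_set_drop_if_distinct[OF assms(1), of m m] by blast
  qed simp
qed

text \<open>Some vertex has first component 0, since otherwise a full turn would lower that
  component by the length of \<open>w\<close>. The walk is cut after the vertex
  \<open>(0, h)\<close> with the largest \<open>h\<close>.\<close>

lemma ex_rotate_canonical:
  assumes w: "w \<in> closed_walks n"
  shows "\<exists>k. rotate k w \<in> canonical_walks n"
proof -
  have w': "w \<noteq> []" "walk (last w) w"
    using w by (auto simp: closed_walks_def)
  define C where "C = {c. (0, c) \<in> set w}"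
  have "C \<subseteq> snd ` set w"
    by (force simp: C_def)
  then have "finite C"
    using finite_subset by blast
  have "C \<noteq> {}"
  proof
    assume "C = {}"
    then have nz: "fst v \<noteq> 0" if "v \<in> set w" for v
      using that by (cases v) (metis C_def empty_iff fst_conv mem_Collect_eq)
    have "fst v \<noteq> 0" if "v \<in> set (last w # w)" for v
      using that nz[of v] nz[OF last_in_set[OF w'(1)]] by (cases "v = last w") simp_all
    then have "fst (last (last w # w)) + length w = fst (last w)"
      by (rule walk_without_landing[OF w'(2)])
    then show False
      using w'(1) by simp
  qed
  define h where "h = Max C"
  have h: "h \<in> C" "\<And>c. c \<in> C \<Longrightarrow> c \<le> h"
    unfolding h_def using \<open>finite C\<close> \<open>C \<noteq> {}\<close> by auto
  then obtain xs ys where "w = xs @ (0, h) # ys"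
    by (metis (mono_tags, lifting) C_def mem_Collect_eq split_list)
  then have eq: "w = (xs @ [(0, h)]) @ ys"
    by simp
  have rot: "rotate (length (xs @ [(0, h)])) w = ys @ xs @ [(0, h)]"
    unfolding eq rotate_append by simp
  have "last (rotate (length (xs @ [(0, h)])) w) = (0, h)"
    unfolding rot by simp
  moreover have "\<forall>c. (0, c) \<in> set (rotate (length (xs @ [(0, h)])) w) \<longrightarrow> c \<le> h"
    using h(2) by (simp add: C_def)
  ultimately have "rotate (length (xs @ [(0, h)])) w \<in> canonical_walks n"
    using rotate_closed_walks[OF w, of "length (xs @ [(0, h)])"]
    unfolding canonical_walks_def mem_Collect_eq by blast
  then show ?thesis ..
qed

lemma rotate_canonical_unique:
  assumes "w \<in> canonical_walks n" "rotate k w \<in> canonical_walks n"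
  shows "rotate k w = w"
proof -
  obtain h h' where h: "last w = (0, h)" "\<forall>c. (0, c) \<in> set w \<longrightarrow> c \<le> h"
    and h': "last (rotate k w) = (0, h')" "\<forall>c. (0, c) \<in> set w \<longrightarrow> c \<le> h'"
    using assms by (auto simp: canonical_walks_def)
  have w: "w \<noteq> []" "distinct w"
    using assms(1) by (auto simp: canonical_walks_def closed_walks_def)
  have "(0, h) \<in> set w"
    using h(1) w(1) last_in_set by metis
  moreover have "(0, h') \<in> set w"
    using h'(1) w(1) last_in_set[of "rotate k w"] by simp
  ultimately have "h = h'"
    using h(2) h'(2) by (meson le_antisym)
  then show ?thesis
    using h(1) h'(1) w(2) by (intro rotate_same_last) auto
qed

lemma P_2_eq_card_canonical_walks: "P n 2 = card (canonical_walks n)"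
proof -
  have sub: "canonical_walks n \<subseteq> closed_walks n"
    by (auto simp: canonical_walks_def)
  have inj: "inj_on cycle_of (closed_walks n)"
    by (intro inj_onI cycle_of_inject)
  have "card (cycles_of_length n 2 // cyclic_shift) = card (cycle_of ` canonical_walks n)"
  proof (rule card_quotient_representatives)
    show "cycle_of ` canonical_walks n \<subseteq> cycles_of_length n 2"
      using sub by (auto simp: cycles_of_length_eq)
  next
    fix p assume "p \<in> cycles_of_length n 2"
    then obtain w where w: "w \<in> closed_walks n" "p = cycle_of w"
      by (auto simp: cycles_of_length_eq)
    obtain k where k: "rotate k w \<in> canonical_walks n"
      using ex_rotate_canonical[OF w(1)] ..
    have "cycle_of (rotate k w) = rotate k p"
      using w by (auto simp: cycle_of_rotate closed_walks_def)
    then have "cyclic_shift `` {p} = cyclic_shift `` {cycle_of (rotate k w)}"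
      by (simp add: cyclic_shift_Image_rotate)
    then show "\<exists>q\<in>cycle_of ` canonical_walks n. cyclic_shift `` {p} = cyclic_shift `` {q}"
      using k by blast
  next
    fix p q assume "p \<in> cycle_of ` canonical_walks n" "q \<in> cycle_of ` canonical_walks n"
      and eq: "cyclic_shift `` {p} = cyclic_shift `` {q}"
    then obtain w w' where w: "w \<in> canonical_walks n" "p = cycle_of w"
      and w': "w' \<in> canonical_walks n" "q = cycle_of w'"
      by auto
    have "q \<in> cyclic_shift `` {q}"
      by (auto simp: cyclic_shift_def intro: exI[of _ 0])
    then obtain k where "q = rotate k p"
      using eq by (auto simp: cyclic_shift_def)
    then have "cycle_of w' = cycle_of (rotate k w)"
      using w w' sub by (subst cycle_of_rotate) (auto simp: closed_walks_def)
    then have "w' = rotate k w"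
      using w(1) w'(1) sub rotate_closed_walks inj_onD[OF inj] by blast
    then show "p = q"
      using rotate_canonical_unique[OF w(1), of k] w w' by simp
  qed
  then show ?thesis
    unfolding P_def using card_image[OF inj_on_subset[OF inj sub]] by simp
qed

section \<open>Closed walks as arrangements of gaps\<close>

fun descent :: "nat \<Rightarrow> nat \<Rightarrow> (nat \<times> nat) list" where
  "descent 0 c = []"
| "descent (Suc k) c = (k, c) # descent k c"

text \<open>Here \<open>b\<close> is the gap of the current state \<open>(0, b)\<close>. The next
  state is \<open>(b - 1, c)\<close> for an unmarked \<open>c\<close> and
  \<open>(b - c - 1, c)\<close> for a marked one; both descend to \<open>(0, c)\<close>.\<close>

fun expand :: "nat \<Rightarrow> (nat \<times> bool) list \<Rightarrow> (nat \<times> nat) list" where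
  "expand b [] = []"
| "expand b ((c, m) # l) = descent (if m then b - c else b) c @ expand c l"

lemma length_descent [simp]: "length (descent k c) = k"
  by (induction k) auto

lemma set_descent: "set (descent k c) = {..<k} \<times> {c}"
  by (induction k) (auto simp: lessThan_Suc)

lemma distinct_descent: "distinct (descent k c)"
  by (induction k) (auto simp: set_descent)

lemma descent_eq_Nil_iff [simp]: "descent k c = [] \<longleftrightarrow> k = 0"
  by (cases k) auto

lemma last_descent: "0 < k \<Longrightarrow> last (descent k c) = (0, c)"
  by (induction k) auto

lemma walk_descent_append: "1 \<le> c \<Longrightarrow> walk (k, c) (descent k c @ w) \<longleftrightarrow> walk (0, c) w"
  by (induction k) (auto simp: step_def)

lemma expand_append: "expand b (xs @ ys) = expand b xs @ expand (last (b # map fst xs)) ys"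
  by (induction b xs rule: expand.induct) auto

lemma walk_expand:
  assumes "valid_marks b l" "0 \<notin> fst ` set l" "1 \<le> b"
  shows "walk (0, b) (expand b l)"
  using assms
proof (induction b l rule: expand.induct)
  case (2 b c m l)
  then have c: "1 \<le> c" and IH: "walk (0, c) (expand c l)"
    by auto
  have "0 < (if m then b - c else b)"
    using 2 by auto
  then obtain k where k: "(if m then b - c else b) = Suc k"
    using gr0_conv_Suc by blast
  then have "step (0, b) (k, c)"
    using 2 by (auto simp: step_def split: if_splits)
  then show ?case
    using c IH by (simp add: k walk_descent_append)
qed simp

text \<open>Allowing a start \<open>(x, c)\<close> in the middle of a descent makes induction over
  single steps possible; \<open>x = 0\<close> is the case of interest.\<close>

lemma ex_expand:
  assumes "walk (x, c) w" "fst (last ((x, c) # w)) = 0"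
  shows "\<exists>l. valid_marks c l \<and> 0 \<notin> fst ` set l \<and> w = descent x c @ expand c l"
  using assms
proof (induction w arbitrary: x c)
  case Nil
  then show ?case
    by (intro exI[of _ "[]"]) simp
next
  case (Cons v w)
  obtain x' c' where v: "v = (x', c')"
    by fastforce
  have c': "1 \<le> c'" and st: "step (x, c) (x', c')"
    using Cons.prems v by auto
  obtain l where l: "valid_marks c' l" "0 \<notin> fst ` set l" "w = descent x' c' @ expand c' l"
    using Cons.IH[of x' c'] Cons.prems v by auto
  show ?case
  proof (cases x)
    case 0
    \<comment> \<open>The two disjuncts of \<open>step\<close> exclude each other because
      \<open>c' \<ge> 1\<close>, so the mark can be read off.\<close>
    define m where "m \<longleftrightarrow> c \<noteq> Suc x'"
    have "(if m then c - c' else c) = Suc x'" "m \<longrightarrow> c' < c"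
      using st 0 by (auto simp: m_def step_def)
    then show ?thesis
      using l c' 0 v by (intro exI[of _ "(c', m) # l"]) auto
  next
    case (Suc y)
    then have "x' = y" "c' = c"
      using st by (auto simp: step_def)
    then show ?thesis
      using l v Suc by (intro exI[of _ l]) auto
  qed
qed

text \<open>Each entry costs its predecessor, minus itself if marked. Adding the last gap turns the
  sum of predecessors into \<open>b\<close> plus the sum of all entries, and the marked ones
  cancel.\<close>

lemma length_expand:
  "valid_marks b l \<Longrightarrow> length (expand b l) + last (b # map fst l) = b + (\<Sum>(c, m)\<leftarrow>l. if m then 0 else c)"
proof (induction b l rule: expand.induct)
  case (2 b c m l)
  then have "length (expand c l) + last (c # map fst l) = c + (\<Sum>(c, m)\<leftarrow>l. if m then 0 else c)"
    by simp
  then show ?case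
    using 2 by auto
qed simp

lemma sum_unmarked:
  "distinct (map fst l) \<Longrightarrow> (\<Sum>(c, m)\<leftarrow>l. if m then 0 else c) = \<Sum>{c. (c, False) \<in> set l}"
proof (induction l)
  case (Cons p l)
  obtain c m where p: "p = (c, m)"
    by fastforce
  have fin: "finite {c. (c, False) \<in> set l}"
    by (rule finite_subset[of _ "fst ` set l"]) force+
  have "(c, False) \<notin> set l"
    using Cons.prems p by force
  moreover have "{c'. (c', False) \<in> set (p # l)} =
      (if m then {c. (c, False) \<in> set l} else insert c {c. (c, False) \<in> set l})"
    using p by auto
  ultimately show ?case
    using Cons p fin by simp
qed simp

lemma expand_landing:
  assumes "valid_marks b l" "0 \<notin> fst ` set l" "1 \<le> b"
  shows "(0, c) \<in> set (expand b l) \<longleftrightarrow> c \<in> fst ` set l"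
  using assms by (induction b l rule: expand.induct) (auto simp: set_descent)

lemma snd_expand: "v \<in> set (expand b l) \<Longrightarrow> snd v \<in> fst ` set l"
  by (induction b l rule: expand.induct) (auto simp: set_descent)

text \<open>Descents of different gaps are disjoint, while two descents of the same gap
  \<open>c\<close> share the landing \<open>(0, c)\<close>.\<close>

lemma distinct_expand:
  assumes "valid_marks b l" "0 \<notin> fst ` set l" "1 \<le> b"
  shows "distinct (expand b l) \<longleftrightarrow> distinct (map fst l)"
  using assms
proof (induction b l rule: expand.induct)
  case (2 b c m l)
  define k where "k = (if m then b - c else b)"
  have k: "0 < k"
    using 2 by (auto simp: k_def)
  have l: "valid_marks c l" "0 \<notin> fst ` set l" "1 \<le> c"
    using 2 by auto
  have "set (descent k c) \<inter> set (expand c l) = {} \<longleftrightarrow> c \<notin> fst ` set l"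
  proof
    assume "set (descent k c) \<inter> set (expand c l) = {}"
    moreover have "(0, c) \<in> set (descent k c)"
      using k by (simp add: set_descent)
    ultimately have "(0, c) \<notin> set (expand c l)"
      by blast
    then show "c \<notin> fst ` set l"
      using expand_landing[OF l] by simp
  next
    assume "c \<notin> fst ` set l"
    then show "set (descent k c) \<inter> set (expand c l) = {}"
      using snd_expand[of _ c l] by (fastforce simp: set_descent)
  qed
  then show ?case
    using 2 l distinct_descent by (auto simp: k_def[symmetric])
qed simp

text \<open>The first vertex \<open>(k, c)\<close> reveals the next gap \<open>c\<close>, and
  \<open>k + 1\<close> is \<open>b\<close> or \<open>b - c\<close> according to the mark; these
  differ as \<open>c\<close> is positive.\<close>

lemma expand_inject:
  assumes "valid_marks b l" "0 \<notin> fst ` set l" "1 \<le> b" "valid_marks b l'" "0 \<notin> fst ` set l'"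
    and "expand b l = expand b l'"
  shows "l = l'"
  using assms
proof (induction b l arbitrary: l' rule: expand.induct)
  case (1 b)
  then show ?case
    by (cases l') (auto split: if_splits)
next
  case (2 b c m l)
  have "0 < (if m then b - c else b)"
    using 2 by auto
  then obtain k where k: "(if m then b - c else b) = Suc k"
    using gr0_conv_Suc by blast
  have "l' \<noteq> []"
    using 2 k by auto
  then obtain c' m' l'' where l': "l' = (c', m') # l''"
    by (cases l') auto
  have "0 < (if m' then b - c' else b)"
    using 2 l' by auto
  then obtain k' where k': "(if m' then b - c' else b) = Suc k'"
    using gr0_conv_Suc by blast
  have eq: "(k, c) # descent k c @ expand c l = (k', c') # descent k' c' @ expand c' l''"
    using 2(7) unfolding l' expand.simps k k' descent.simps append_Cons .
  then have kc: "k' = k" "c' = c"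
    by simp_all
  then have "expand c l = expand c l''"
    using eq by (simp only: kc list.inject same_append_eq)
  moreover have "m = m'"
    using k k' kc 2 by (auto split: if_splits)
  ultimately show ?case
    using 2 l' kc by auto
qed

text \<open>The arrangement is closed by returning to \<open>h\<close>, which is unmarked because no
  predecessor exceeds the largest gap.\<close>

definition closed_expand :: "nat \<Rightarrow> (nat \<times> bool) list \<Rightarrow> (nat \<times> nat) list" where
  "closed_expand h l = expand h (l @ [(h, False)])"

text \<open>The unmarked gaps sum to the period, so \<open>T\<close> determines the largest gap as
  \<open>n - \<Sum>T\<close>; it must be positive and exceed all of \<open>T\<close>.\<close>

definition head_sets :: "nat \<Rightarrow> nat set set" where
  "head_sets n = {T. finite T \<and> 0 \<notin> T \<and> \<Sum>T < n \<and> T \<subseteq> {..<n - \<Sum>T}}"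

lemma last_closed_expand:
  assumes "1 \<le> h" "0 \<notin> fst ` set l"
  shows "last (closed_expand h l) = (0, h)"
proof -
  define b where "b = last (h # map fst l)"
  have "b \<in> insert h (fst ` set l)"
    unfolding b_def by (cases l rule: rev_cases) auto
  then have "0 < b"
    using assms by (cases b) auto
  moreover have "closed_expand h l = expand h l @ descent b h"
    unfolding closed_expand_def expand_append b_def by simp
  ultimately show ?thesis
    by (simp add: last_append last_descent)
qed

text \<open>A canonical walk starts and ends at \<open>(0, h)\<close>, so its decoded list of gaps
  ends in \<open>h\<close>; maximality forces that entry to be unmarked. The length formula then
  yields \<open>n = \<Sum>T + h\<close>.\<close>

lemma canonical_walks_eq:
  "canonical_walks n = (\<lambda>(T, l). closed_expand (n - \<Sum>T) l) ` (SIGMA T:head_sets n. configs (n - \<Sum>T) 1 T)"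
proof (intro equalityI subsetI)
  fix w assume "w \<in> canonical_walks n"
  then obtain h where w: "w \<noteq> []" "length w = n" "distinct w" "walk (0, h) w"
      "last w = (0, h)" "\<And>c. (0, c) \<in> set w \<Longrightarrow> c \<le> h"
    by (auto simp: canonical_walks_def closed_walks_def)
  have h: "1 \<le> h"
    using walk_snd_pos[OF w(4) last_in_set[OF w(1)]] w(5) by simp
  obtain L where L: "valid_marks h L" "0 \<notin> fst ` set L" "w = expand h L"
    using ex_expand[OF w(4)] w(1,5) by auto
  then have "L \<noteq> []"
    using w(1) by auto
  then obtain l c m where l: "L = l @ [(c, m)]"
    by (metis rev_exhaust surj_pair)
  have le: "c' \<le> h" if "c' \<in> fst ` set L" for c'
    using w(6) expand_landing[OF L(1,2) h] L(3) that by simp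
  define b where "b = last (h # map fst l)"
  have b: "b \<in> insert h (fst ` set l)"
    unfolding b_def by (cases l rule: rev_cases) auto
  have ch: "valid_marks h l" "m \<longrightarrow> c < b"
    using L(1) by (auto simp: l valid_marks_append b_def)
  define k where "k = (if m then b - c else b)"
  have "0 \<notin> fst ` set l"
    using L(2) l by simp
  then have "b \<noteq> 0"
    using b h by (cases b) auto
  then have "0 < k"
    using ch(2) by (simp add: k_def)
  have "w = expand h l @ descent k c"
    unfolding L(3) l expand_append b_def k_def by simp
  then have "last w = (0, c)"
    using \<open>0 < k\<close> by (simp add: last_append last_descent)
  then have c: "c = h"
    using w(5) by simp
  then have "\<not> m"
    using ch(2) b le l by fastforce
  then have weq: "w = closed_expand h l"
    using L(3) l c by (simp add: closed_expand_def)
  have dist: "distinct (map fst L)"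
    using w(3) distinct_expand[OF L(1,2) h] L(3) by simp
  define T where "T = {c. (c, False) \<in> set l}"
  have "length w + h = h + (\<Sum>(c, m)\<leftarrow>L. if m then 0 else c)"
    using length_expand[OF L(1)] L(3) l c by simp
  also have "(\<Sum>(c, m)\<leftarrow>L. if m then 0 else c) = \<Sum>T + h"
    using sum_unmarked[of l] dist \<open>\<not> m\<close> by (simp add: l c T_def)
  finally have n: "n = \<Sum>T + h"
    using w(2) by simp
  have vals: "fst ` set l \<subseteq> {1..<h}"
  proof
    fix x assume x: "x \<in> fst ` set l"
    then have "x \<le> h" "x \<noteq> 0" "x \<noteq> h"
      using le L(2) dist l c by auto
    then show "x \<in> {1..<h}"
      by simp
  qed
  have "T \<subseteq> fst ` set l"
    by (force simp: T_def)
  then have T: "T \<subseteq> {1..<h}" "finite T"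
    using vals finite_subset by blast+
  have hn: "n - \<Sum>T = h"
    using n by simp
  have "l \<in> configs h 1 T"
    using ch(1) dist vals l by (simp add: configs_def T_def)
  moreover have "T \<in> head_sets n"
    using T n h unfolding head_sets_def hn by auto
  ultimately show "w \<in> (\<lambda>(T, l). closed_expand (n - \<Sum>T) l) ` (SIGMA T:head_sets n. configs (n - \<Sum>T) 1 T)"
    using weq hn by (intro image_eqI[of _ _ "(T, l)"]) auto
next
  fix w assume "w \<in> (\<lambda>(T, l). closed_expand (n - \<Sum>T) l) ` (SIGMA T:head_sets n. configs (n - \<Sum>T) 1 T)"
  then obtain T l where Tl: "T \<in> head_sets n" "l \<in> configs (n - \<Sum>T) 1 T" "w = closed_expand (n - \<Sum>T) l"
    by auto
  define h where "h = n - \<Sum>T"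
  have h: "1 \<le> h" "n = \<Sum>T + h"
    using Tl(1) by (auto simp: head_sets_def h_def)
  have l: "valid_marks h l" "distinct (map fst l)" "fst ` set l \<subseteq> {1..<h}" "T = {c. (c, False) \<in> set l}"
    using Tl(2) by (auto simp: configs_def h_def)
  define L where "L = l @ [(h, False)]"
  have L: "valid_marks h L" "0 \<notin> fst ` set L" "distinct (map fst L)"
    using l h(1) by (auto simp: L_def valid_marks_append)
  have w: "w = expand h L"
    using Tl(3) by (simp add: closed_expand_def h_def L_def)
  have last: "last w = (0, h)"
    using last_closed_expand[OF h(1), of l] L(2) Tl(3) by (simp add: h_def L_def)
  have len: "length w = n"
    using length_expand[OF L(1)] sum_unmarked[OF l(2)] l(4) h(2) by (simp add: w L_def)
  then have "w \<noteq> []"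
    using h by auto
  moreover have "walk (last w) w"
    using walk_expand[OF L(1,2) h(1)] last w by simp
  moreover have "distinct w"
    using distinct_expand[OF L(1,2) h(1)] L(3) w by simp
  moreover have "c \<le> h" if "(0, c) \<in> set w" for c
  proof -
    have "c \<in> fst ` set L"
      using expand_landing[OF L(1,2) h(1)] that w by simp
    then show ?thesis
      using l(3) by (auto simp: L_def)
  qed
  ultimately show "w \<in> canonical_walks n"
    using len last by (simp add: canonical_walks_def closed_walks_def)
qed

lemma finite_head_sets: "finite (head_sets n)"
proof (rule finite_subset)
  show "head_sets n \<subseteq> Pow {..<n}"
    by (force simp: head_sets_def)
qed simp

text \<open>A walk determines its data: the final vertex gives \<open>h\<close>, injectivity of
  \<open>expand\<close> gives \<open>l\<close>, and the unmarked entries of \<open>l\<close> form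
  \<open>T\<close>.\<close>

lemma card_canonical_walks:
  "card (canonical_walks n) = (\<Sum>T\<in>head_sets n. card (configs (n - \<Sum>T) 1 T))"
proof -
  have "inj_on (\<lambda>(T, l). closed_expand (n - \<Sum>T) l) (SIGMA T:head_sets n. configs (n - \<Sum>T) 1 T)"
  proof (rule inj_onI, clarify)
    fix T l T' l'
    assume T: "T \<in> head_sets n" "T' \<in> head_sets n"
      and l: "l \<in> configs (n - \<Sum>T) 1 T" and l': "l' \<in> configs (n - \<Sum>T') 1 T'"
      and eq: "closed_expand (n - \<Sum>T) l = closed_expand (n - \<Sum>T') l'"
    have h: "1 \<le> n - \<Sum>T" "1 \<le> n - \<Sum>T'"
      using T by (auto simp: head_sets_def)
    moreover have "0 \<notin> fst ` set l" "0 \<notin> fst ` set l'"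
      using l l' by (auto simp: configs_def)
    ultimately have hh: "n - \<Sum>T' = n - \<Sum>T"
      using last_closed_expand[of "n - \<Sum>T" l] last_closed_expand[of "n - \<Sum>T'" l'] eq by simp
    have c: "valid_marks (n - \<Sum>T) (l @ [(n - \<Sum>T, False)])" "0 \<notin> fst ` set (l @ [(n - \<Sum>T, False)])"
      using l h(1) by (auto simp: configs_def valid_marks_append)
    have c': "valid_marks (n - \<Sum>T) (l' @ [(n - \<Sum>T, False)])" "0 \<notin> fst ` set (l' @ [(n - \<Sum>T, False)])"
      using l' h(1) unfolding hh by (auto simp: configs_def valid_marks_append)
    have "l @ [(n - \<Sum>T, False)] = l' @ [(n - \<Sum>T, False)]"
      using expand_inject[OF c h(1) c'] eq unfolding hh closed_expand_def by blast
    then have "l = l'"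
      by simp
    then show "T = T' \<and> l = l'"
      using l l' unfolding configs_def by blast
  qed
  then show ?thesis
    unfolding canonical_walks_eq
    by (simp add: card_image card_SigmaI finite_head_sets finite_configs)
qed

text \<open>The exponent \<open>h + \<Sum>T\<close> equals \<open>n\<close> for every
  \<open>T\<close>, so the power of 2 factors out and \<open>n\<close> survives only in the range of
  summation.\<close>

lemma P_2_eq_sum_weight: "real (P n 2) = (\<Sum>T\<in>head_sets n. weight T) * 2 ^ n"
proof -
  have "real (card (configs (n - \<Sum>T) 1 T)) = weight T * 2 ^ n" if "T \<in> head_sets n" for T
  proof -
    have "T \<subseteq> {1..<n - \<Sum>T}"
    proof
      fix t assume t: "t \<in> T"
      have "0 \<notin> T" "T \<subseteq> {..<n - \<Sum>T}"
        using that by (simp_all add: head_sets_def)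
      then have "t \<noteq> 0" "t \<in> {..<n - \<Sum>T}"
        using t by (metis, blast)
      then show "t \<in> {1..<n - \<Sum>T}"
        by simp
    qed
    moreover have "1 \<le> n - \<Sum>T" "n - \<Sum>T + \<Sum>T = n"
      using that by (auto simp: head_sets_def)
    ultimately show ?thesis
      using card_configs_eq_weight[of T "n - \<Sum>T"] by simp
  qed
  then show ?thesis
    by (simp add: P_2_eq_card_canonical_walks card_canonical_walks sum_distrib_right)
qed

section \<open>The limit\<close>

text \<open>The sets \<open>head_sets n\<close> eventually contain any given finite family of
  admissible \<open>T\<close>, so their partial sums follow the filter that defines the infinite
  sum.\<close>

lemma P_2_asymptotic: "(\<lambda>n. real (P n 2) / 2 ^ n) \<longlonglongrightarrow> juggling_gamma"
proof -
  have "filterlim head_sets (finite_subsets_at_top {T. finite T \<and> 0 \<notin> T}) sequentially"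
    unfolding filterlim_finite_subsets_at_top
  proof (intro allI impI)
    fix X :: "nat set set" assume X: "finite X \<and> X \<subseteq> {T. finite T \<and> 0 \<notin> T}"
    have "\<forall>\<^sub>F n in sequentially. T \<in> head_sets n" if "T \<in> X" for T
    proof (rule eventually_sequentiallyI)
      \<comment> \<open>This threshold gives \<open>n - \<Sum>T > \<Sum>T\<close>, and
        \<open>\<Sum>T\<close> bounds every element of \<open>T\<close>.\<close>
      fix n assume n: "Suc (\<Sum>T + \<Sum>T) \<le> n"
      have T: "finite T" "0 \<notin> T"
        using X that by auto
      have "t \<le> \<Sum>T" if "t \<in> T" for t
        using member_le_sum[of t T "\<lambda>t. t"] that T(1) by simp
      then have "t < n - \<Sum>T" if "t \<in> T" for t
        using n that by fastforce
      then show "T \<in> head_sets n"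
        using T n by (auto simp: head_sets_def)
    qed
    then have "\<forall>\<^sub>F n in sequentially. \<forall>T\<in>X. T \<in> head_sets n"
      using X by (intro eventually_ball_finite) auto
    then show "\<forall>\<^sub>F n in sequentially. finite (head_sets n) \<and> X \<subseteq> head_sets n \<and>
        head_sets n \<subseteq> {T. finite T \<and> 0 \<notin> T}"
      by eventually_elim (auto simp: finite_head_sets, auto simp: head_sets_def)
  qed
  then have "(\<lambda>n. sum weight (head_sets n)) \<longlonglongrightarrow> juggling_gamma"
    using has_sum_weight unfolding has_sum_def by (rule filterlim_compose[rotated])
  then show ?thesis
    by (simp add: P_2_eq_sum_weight)
qed

theorem theorem3p1:
  shows "(\<exists>\<epsilon> :: nat \<Rightarrow> real. \<epsilon> \<in> o(\<lambda>_. 1) \<and>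
            (\<forall>n\<ge>1. real (P n 2) = (juggling_gamma - \<epsilon> n) * 2 ^ n))
       \<and> 1.3296387925905428331319 \<le> juggling_gamma
       \<and> juggling_gamma < 1.3296387925905428331320"
proof (intro conjI exI allI impI)
  let ?\<epsilon> = "\<lambda>n. juggling_gamma - real (P n 2) / 2 ^ n"
  have "?\<epsilon> \<longlonglongrightarrow> 0"
    using tendsto_diff[OF tendsto_const P_2_asymptotic, of juggling_gamma] by simp
  then show "?\<epsilon> \<in> o(\<lambda>_. 1)"
    by (intro smalloI_tendsto) auto
  show "real (P n 2) = (juggling_gamma - ?\<epsilon> n) * 2 ^ n" for n
    by simp
qed (rule juggling_gamma_bounds)+

end
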